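(* Let $\triangle ABC$ be a triangle with a right angle at $C$ and side lengths $a = BC$, $b = CA$, $c = AB$ (opposite to $A$, $B$ and $C$, respectively). Then for each angle $\theta$ with $45^{\circ} \leq \theta < 90^{\circ}$, the sum of the areas of the $(a,\theta)$-pyramid and the $(b,\theta)$-pyramid equals the area of the $(c,\theta)$-pyramid.
   Context: For $\ell > 0$ and $0^{\circ} < \theta < 90^{\circ}$, an $(\ell,\theta)$-pyramid is an isosceles triangle in the Euclidean plane with base of length $\ell$ and both interior angles at the base equal to $\theta$; it is determined up to congruence by $\ell$ and $\theta$. *)

theory Defs
  imports "HOL-Analysis.Analysis"
begin

(* Interior angle at the vertex Q of the triangle P Q R, in radians.  Only meaningful for
   P, R different from Q; in every use below the three points are not collinear. *)
definition angle_at :: "real ^ 2 \<Rightarrow> real ^ 2 \<Rightarrow> real ^ 2 \<Rightarrow> real" where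
  "angle_at P Q R = arccos (((P - Q) \<bullet> (R - Q)) / (norm (P - Q) * norm (R - Q)))"

(* T is the solid triangle with base PQ and apex R.  It is determined by l and \<theta> only up to
   congruence, hence a predicate on plane regions. *)
definition is_pyramid :: "real \<Rightarrow> real \<Rightarrow> (real ^ 2) set \<Rightarrow> bool" where
  "is_pyramid l \<theta> T \<longleftrightarrow> 0 < l \<and> 0 < \<theta> \<and> \<theta> < pi / 2 \<and>
     (\<exists>P Q R. \<not> collinear {P, Q, R} \<and> T = convex hull {P, Q, R} \<and>
        dist P Q = l \<and> dist P R = dist Q R \<and>
        angle_at Q P R = \<theta> \<and> angle_at P Q R = \<theta>)"

lemma pyramid_exists:
  assumes "0 < l" "0 < \<theta>" "\<theta> < pi / 2"
  shows "\<exists>T. is_pyramid l \<theta> T"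
proof -
  define P Q R :: "real ^ 2" where "P = 0" and "Q = vector [l, 0]"
    and "R = vector [l / 2, l / 2 * tan \<theta>]"
  have c: "cos \<theta> > 0" using assms by (intro cos_gt_zero_pi) auto
  have t: "tan \<theta> > 0" using assms by (intro tan_gt_zero) auto
  have sq: "(l / 2)\<^sup>2 + (l / 2 * tan \<theta>)\<^sup>2 = (l / (2 * cos \<theta>))\<^sup>2"
  proof -
    have "(l / 2)\<^sup>2 + (l / 2 * tan \<theta>)\<^sup>2 = (l / 2)\<^sup>2 * (1 + (tan \<theta>)\<^sup>2)"
      by (simp add: power2_eq_square algebra_simps)
    also have "1 + (tan \<theta>)\<^sup>2 = inverse (cos \<theta>) ^ 2"
      using tan_sec[of \<theta>] c by simp
    finally show ?thesis by (simp add: field_simps power2_eq_square)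
  qed
  have nR: "norm (R - P) = l / (2 * cos \<theta>)" "norm (R - Q) = l / (2 * cos \<theta>)"
    using sq c assms
    by (auto simp: P_def Q_def R_def norm_vec_def L2_set_def sum_2 real_sqrt_unique)
  have nQ: "norm (Q - P) = l" "norm (P - Q) = l"
    using assms by (auto simp: P_def Q_def norm_vec_def L2_set_def sum_2)
  have i: "(Q - P) \<bullet> (R - P) = l * l / 2" "(P - Q) \<bullet> (R - Q) = l * l / 2"
    by (auto simp: P_def Q_def R_def inner_vec_def sum_2 field_simps)
  have ac: "arccos (cos \<theta>) = \<theta>" using assms by (intro arccos_cos) auto
  have "angle_at Q P R = \<theta>" "angle_at P Q R = \<theta>"
    unfolding angle_at_def i nR nQ using assms c ac by (simp_all add: field_simps)
  moreover have "dist P Q = l" "dist P R = dist Q R"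
    using nR nQ by (simp_all add: dist_norm norm_minus_commute)
  moreover have "\<not> collinear {P, Q, R}"
  proof
    assume "collinear {P, Q, R}"
    then have "collinear {0, Q, R}" by (simp add: P_def)
    then consider "Q = 0" | "R = 0" | k where "R = k *\<^sub>R Q"
      unfolding collinear_lemma by auto
    then show False
      using assms t by cases (auto simp: Q_def R_def vec_eq_iff forall_2)
  qed
  ultimately show ?thesis unfolding is_pyramid_def using assms by blast
qed

end

theory Submission
  imports Defs
begin

text \<open>The apex of a pyramid with base \<open>l\<close> lies over the midpoint of the base, so
  each leg has length \<open>l / (2 * cos \<theta>)\<close>. Half the product of base, leg and
  \<open>sin \<theta>\<close> (\<open>measure_triangle_angle\<close>) then gives the area
  (\<open>measure_pyramid\<close>). All three areas share the factor
  \<open>tan \<theta> / 4\<close>, which leaves the relation between the squared sides.\<close>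

text \<open>An \<open>(l, \<theta>)\<close>-pyramid has area \<open>l\<^sup>2 tan \<theta> / 4\<close>, so the claim is a
  constant multiple of the Pythagorean theorem.\<close>

lemma inner_eq_cos_angle_at:
  "(P - Q) \<bullet> (R - Q) = norm (P - Q) * norm (R - Q) * cos (angle_at P Q R)"
proof -
  have "\<bar>((P - Q) \<bullet> (R - Q)) / (norm (P - Q) * norm (R - Q))\<bar> \<le> 1"
    using Cauchy_Schwarz_ineq2[of "P - Q" "R - Q"] by (auto simp: abs_mult divide_le_eq_1)
  then have "cos (angle_at P Q R) = ((P - Q) \<bullet> (R - Q)) / (norm (P - Q) * norm (R - Q))"
    unfolding angle_at_def by (rule cos_arccos_abs)
  then show ?thesis
    by auto
qed

text \<open>Lagrange's identity turns the squared determinant of two edge vectors into the squared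
  product of their lengths and the sine; the sign assumption selects the root.\<close>

lemma measure_triangle_angle:
  fixes P Q R :: "real ^ 2"
  assumes "0 \<le> sin (angle_at Q P R)"
  shows "measure lborel (convex hull {P, Q, R}) =
           norm (Q - P) * norm (R - P) * sin (angle_at Q P R) / 2"
proof -
  \<comment> \<open>Determinant of \<open>R - P\<close> and \<open>Q - P\<close>: twice the signed
    area, in the form used by \<open>content_triangle\<close>.\<close>
  define D where "D = (R $ 1 - P $ 1) * (Q $ 2 - P $ 2) - (Q $ 1 - P $ 1) * (R $ 2 - P $ 2)"
  have "D\<^sup>2 + ((Q - P) \<bullet> (R - P))\<^sup>2 = ((Q - P) \<bullet> (Q - P)) * ((R - P) \<bullet> (R - P))"
    by (simp add: D_def inner_vec_def sum_2 power2_eq_square algebra_simps)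
  then have "D\<^sup>2 = (norm (Q - P) * norm (R - P))\<^sup>2 * (1 - (cos (angle_at Q P R))\<^sup>2)"
    unfolding inner_eq_cos_angle_at[of Q P R] power2_norm_eq_inner[symmetric]
    by (simp add: power_mult_distrib algebra_simps)
  also have "\<dots> = (norm (Q - P) * norm (R - P) * sin (angle_at Q P R))\<^sup>2"
    by (simp add: power_mult_distrib sin_squared_eq)
  finally have "\<bar>D\<bar> = norm (Q - P) * norm (R - P) * sin (angle_at Q P R)"
    using assms by (simp add: power2_eq_iff abs_if) (smt (verit) mult_nonneg_nonneg norm_ge_zero)
  then show ?thesis
    by (simp add: content_triangle D_def)
qed

lemma measure_pyramid:
  assumes "is_pyramid l \<theta> T"
  shows "measure lborel T = l\<^sup>2 * tan \<theta> / 4"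
proof -
  obtain P Q R where T: "T = convex hull {P, Q, R}" and l: "dist P Q = l"
    and iso: "dist P R = dist Q R" and \<theta>: "angle_at Q P R = \<theta>"
    and bounds: "0 < l" "0 < \<theta>" "\<theta> < pi / 2"
    using assms unfolding is_pyramid_def by blast
  have c: "cos \<theta> > 0" and s: "sin \<theta> > 0"
    using bounds by (auto intro: cos_gt_zero_pi sin_gt_zero)
  have nQ: "norm (Q - P) = l"
    using l by (simp add: dist_norm norm_minus_commute)
  have "(R - P) \<bullet> (R - P) = (R - Q) \<bullet> (R - Q)"
    using iso unfolding dist_norm by (metis norm_eq norm_minus_commute)
  \<comment> \<open>Substituting \<open>R - Q = (R - P) - (Q - P)\<close> shows that
    \<open>R\<close> projects to the midpoint of the base.\<close>
  then have "2 * ((Q - P) \<bullet> (R - P)) = (Q - P) \<bullet> (Q - P)"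
    by (simp add: inner_simps inner_commute algebra_simps)
  also have "\<dots> = l\<^sup>2"
    using nQ by (simp add: power2_norm_eq_inner[symmetric])
  finally have "norm (R - P) * cos \<theta> = l / 2"
    using inner_eq_cos_angle_at[of Q P R] bounds nQ \<theta> by (simp add: power2_eq_square)
  then have "norm (R - P) = l / (2 * cos \<theta>)"
    using c by (simp add: field_simps)
  moreover have "measure lborel T = l * norm (R - P) * sin \<theta> / 2"
    using measure_triangle_angle[of Q P R] s nQ \<theta> T by simp
  ultimately show ?thesis
    by (simp add: tan_def power2_eq_square)
qed

theorem theoremB:
  fixes A B C :: "real ^ 2" and a b c \<theta> :: real and Ta Tb Tc :: "(real ^ 2) set"
  assumes "\<not> collinear {A, B, C}"
    and "angle_at A C B = pi / 2"
    and "a = dist B C" and "b = dist C A" and "c = dist A B"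
    and "pi / 4 \<le> \<theta>" and "\<theta> < pi / 2"
    and "is_pyramid a \<theta> Ta" and "is_pyramid b \<theta> Tb" and "is_pyramid c \<theta> Tc"
  shows "measure lborel Ta + measure lborel Tb = measure lborel Tc"
proof -
  have "(A - C) \<bullet> (B - C) = 0"
    unfolding inner_eq_cos_angle_at[of A C B] assms(2) by simp
  \<comment> \<open>Expand the squared norm of \<open>A - B = (A - C) - (B - C)\<close>; the right
    angle removes the mixed term.\<close>
  then have "c\<^sup>2 = a\<^sup>2 + b\<^sup>2"
    unfolding assms(3-5) dist_norm power2_norm_eq_inner
    by (simp add: inner_simps inner_commute algebra_simps)
  with assms(8-10) show ?thesis
    by (simp add: measure_pyramid algebra_simps add_divide_distrib)
qed

end
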